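(* Let $(x_0,y_0)\in\operatorname{dom}h_1\times\operatorname{dom}h_2$, $\delta>0$ and $\lambda=\sqrt{\delta/(8M^2)}$. Then CS-SPP$(x_0,y_0,\lambda)$ is an instance of the inexact proximal point framework IPPF with $\sigma=1$ and, for every $k\ge1$, $(\lambda_k,\delta_k)=(\lambda,\delta)$, $(\tilde x_k,\tilde y_k)=(x_k,y_k)$, where $(x_k,y_k)$ are the CS-SPP iterates, and $\varepsilon_k=\varepsilon_k^x+\varepsilon_k^y$ where $$\varepsilon_k^x=f(x_k,y_{k-1})-\ell_{f(\cdot,y_{k-1})}(x_k;x_{k-1}),\qquad \varepsilon_k^y=-f(x_{k-1},y_k)+\ell_{f(x_{k-1},\cdot)}(y_k;y_{k-1}).$$
   Context: Saddle-point problem. $f(x,y)$, $(x,y)\in\mathbb R^n\times\mathbb R^m$, is convex in $x$ and concave in $y$; $h_1:\mathbb R^n\to\mathbb R\cup\{+\infty\}$ and $h_2:\mathbb R^m\to\mathbb R\cup\{+\infty\}$ are proper lower semicontinuous convex with $\operatorname{dom}h_1\times\operatorname{dom}h_2\subset\operatorname{dom}f$. The problem is $\min_x\max_y\{\phi(x,y)=f(x,y)+h_1(x)-h_2(y)\}$. Assumptions: there are maps $f_x',f_y'$ on $\operatorname{dom}h_1\times\operatorname{dom}h_2$ with $f_x'(u,v)$ a subgradient of $f(\cdot,v)$ at $u$ and $f_y'(u,v)$ a supergradient of $f(u,\cdot)$ at $v$; $\|f_x'(u,v)\|\le M$ and $\|f_y'(u,v)\|\le M$ for all $(u,v)\in\operatorname{dom}h_1\times\operatorname{dom}h_2$,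 for some $M>0$; $\operatorname{dom}h_1\times\operatorname{dom}h_2$ is bounded with diameter $D>0$; the set of saddle points is nonempty. Write $\ell_{f(\cdot,y)}(u;x)=f(x,y)+\langle f_x'(x,y),u-x\rangle$ and $\ell_{f(x,\cdot)}(v;y)=f(x,y)+\langle f_y'(x,y),v-y\rangle$. CS-SPP$(x_0,y_0,\lambda)$ (composite subgradient method): for $k\ge1$, $x_k=\operatorname{argmin}_u\{\ell_{f(\cdot,y_{k-1})}(u;x_{k-1})+h_1(u)+\frac1{2\lambda}\|u-x_{k-1}\|^2\}$, $y_k=\operatorname{argmin}_v\{-\ell_{f(x_{k-1},\cdot)}(v;y_{k-1})+h_2(v)+\frac1{2\lambda}\|v-y_{k-1}\|^2\}$. IPPF with parameter $\sigma\in[0,1]$ and initial pair $(x_0,y_0)\in\operatorname{dom}h_1\times\operatorname{dom}h_2$: a method is an instance of IPPF if for every $k\ge1$ it has $\lambda_k>0$, $\varepsilon_k\ge0$, $\delta_k>0$ and pairs $(x_k,y_k),(\tilde x_k,\tilde y_k)\in\operatorname{dom}h_1\times\operatorname{dom}h_2$ such that (1) $\left(\frac{x_{k-1}-x_k}{\lambda_k},\frac{y_{k-1}-y_k}{\lambda_k}\right)\in\partial_{\varepsilon_k}[\phi(\cdot,y_{k-1})-\phi(x_{k-1},\cdot)](\tilde x_k,\tilde y_k)$, where the function is $(u,v)\mapsto\phi(u,y_{k-1})-\phi(x_{k-1},v)$ (taken as $+\infty$ off $\operatorname{dom}h_1\times\operatorname{dom}h_2$) and $\partial_\varepsilon F(z)=\{s:F(w)\ge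 F(z)+\langle s,w-z\rangle-\varepsilon\ \forall w\}$; (2) $\|x_k-\tilde x_k\|^2+\|y_k-\tilde y_k\|^2+2\lambda_k\varepsilon_k\le\delta_k+\sigma(\|\tilde x_k-x_{k-1}\|^2+\|\tilde y_k-y_{k-1}\|^2)$. *)

theory Defs
  imports "HOL-Analysis.Analysis"
begin

text \<open>
  Extended-real-valued functions have type \<^typ>\<open>ereal\<close>.  Mind that in \<^typ>\<open>ereal\<close>
  the indeterminate forms \<open>\<infinity> + (-\<infinity>)\<close> and \<open>\<infinity> - \<infinity>\<close> both evaluate to \<open>\<infinity>\<close>; the definitions below are
  arranged so that they do not occur for the problem data considered.
\<close>

subsection \<open>Extended-real-valued convex functions\<close>

definition eff_dom :: "('a \<Rightarrow> ereal) \<Rightarrow> 'a set" where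
  "eff_dom h = {x. h x < \<infinity>}"

text \<open>Convexity is convexity of the epigraph, so that the value \<open>-\<infinity>\<close> is allowed.\<close>

definition ereal_convex :: "('a::euclidean_space \<Rightarrow> ereal) \<Rightarrow> bool" where
  "ereal_convex h \<longleftrightarrow> convex {(x, r::real). h x \<le> ereal r}"

definition ereal_concave :: "('a::euclidean_space \<Rightarrow> ereal) \<Rightarrow> bool" where
  "ereal_concave h \<longleftrightarrow> ereal_convex (\<lambda>x. - h x)"

definition proper :: "('a \<Rightarrow> ereal) \<Rightarrow> bool" where
  "proper h \<longleftrightarrow> (\<forall>x. h x \<noteq> -\<infinity>) \<and> (\<exists>x. h x < \<infinity>)"

definition lsc :: "('a::euclidean_space \<Rightarrow> ereal) \<Rightarrow> bool" where
  "lsc h \<longleftrightarrow> (\<forall>x. h x \<le> Liminf (at x) h)"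

definition subgradient :: "('a::euclidean_space \<Rightarrow> ereal) \<Rightarrow> 'a \<Rightarrow> 'a \<Rightarrow> bool" where
  "subgradient h u s \<longleftrightarrow> (\<forall>w. h w \<ge> h u + ereal (s \<bullet> (w - u)))"

definition supergradient :: "('a::euclidean_space \<Rightarrow> ereal) \<Rightarrow> 'a \<Rightarrow> 'a \<Rightarrow> bool" where
  "supergradient h u s \<longleftrightarrow> (\<forall>w. h w \<le> h u + ereal (s \<bullet> (w - u)))"

definition eps_subdifferential :: "real \<Rightarrow> ('a::euclidean_space \<Rightarrow> ereal) \<Rightarrow> 'a \<Rightarrow> 'a set" where
  "eps_subdifferential \<epsilon> F z = {s. \<forall>w. F w \<ge> F z + ereal (s \<bullet> (w - z)) - ereal \<epsilon>}"

subsection \<open>The saddle-point problem\<close>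

text \<open>Where the convex-concave function \<open>f\<close> is finite.  This set contains the effective domain
  of \<open>f\<close> in the sense of Rockafellar.\<close>

definition saddle_dom :: "('a \<Rightarrow> 'b \<Rightarrow> ereal) \<Rightarrow> ('a \<times> 'b) set" where
  "saddle_dom f = {(x, y). \<bar>f x y\<bar> \<noteq> \<infinity>}"

definition saddle_fun ::
  "('a \<Rightarrow> 'b \<Rightarrow> ereal) \<Rightarrow> ('a \<Rightarrow> ereal) \<Rightarrow> ('b \<Rightarrow> ereal) \<Rightarrow> 'a \<Rightarrow> 'b \<Rightarrow> ereal" where
  "saddle_fun f h1 h2 x y = f x y + h1 x - h2 y"

text \<open>The competitors range over \<open>dom h1\<close> and \<open>dom h2\<close>, where \<^const>\<open>saddle_fun\<close> is finite;
  outside, \<open>f x y + h1 x - h2 y\<close> may be an indeterminate form.\<close>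

definition saddle_points ::
  "('a \<Rightarrow> 'b \<Rightarrow> ereal) \<Rightarrow> ('a \<Rightarrow> ereal) \<Rightarrow> ('b \<Rightarrow> ereal) \<Rightarrow> ('a \<times> 'b) set" where
  "saddle_points f h1 h2 = {(x, y) \<in> eff_dom h1 \<times> eff_dom h2.
     \<forall>u \<in> eff_dom h1. \<forall>v \<in> eff_dom h2.
       saddle_fun f h1 h2 x v \<le> saddle_fun f h1 h2 x y \<and>
       saddle_fun f h1 h2 x y \<le> saddle_fun f h1 h2 u y}"

text \<open>\<open>lin_x f fx x y u\<close> is the linearization of \<open>f(\<cdot>, y)\<close> at \<open>x\<close>, evaluated at \<open>u\<close>;
  \<open>lin_y f fy x y v\<close> is that of \<open>f(x, \<cdot>)\<close> at \<open>y\<close>, evaluated at \<open>v\<close>.\<close>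

definition lin_x ::
  "('a::euclidean_space \<Rightarrow> 'b \<Rightarrow> ereal) \<Rightarrow> ('a \<Rightarrow> 'b \<Rightarrow> 'a) \<Rightarrow> 'a \<Rightarrow> 'b \<Rightarrow> 'a \<Rightarrow> ereal" where
  "lin_x f fx x y u = f x y + ereal (fx x y \<bullet> (u - x))"

definition lin_y ::
  "('a \<Rightarrow> 'b::euclidean_space \<Rightarrow> ereal) \<Rightarrow> ('a \<Rightarrow> 'b \<Rightarrow> 'b) \<Rightarrow> 'a \<Rightarrow> 'b \<Rightarrow> 'b \<Rightarrow> ereal" where
  "lin_y f fy x y v = f x y + ereal (fy x y \<bullet> (v - y))"

subsection \<open>The composite subgradient method\<close>

text \<open>\<^const>\<open>arg_min\<close> selects some minimizer if there is one.  Here the objectives are proper, lower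
  semicontinuous and strongly convex, so the minimizer exists and is unique.\<close>

primrec cs_spp ::
  "('a::euclidean_space \<Rightarrow> 'b::euclidean_space \<Rightarrow> ereal) \<Rightarrow> ('a \<Rightarrow> 'b \<Rightarrow> 'a) \<Rightarrow> ('a \<Rightarrow> 'b \<Rightarrow> 'b) \<Rightarrow>
   ('a \<Rightarrow> ereal) \<Rightarrow> ('b \<Rightarrow> ereal) \<Rightarrow> 'a \<Rightarrow> 'b \<Rightarrow> real \<Rightarrow> nat \<Rightarrow> 'a \<times> 'b" where
  "cs_spp f fx fy h1 h2 x0 y0 lam 0 = (x0, y0)"
| "cs_spp f fx fy h1 h2 x0 y0 lam (Suc k) =
    (let (x, y) = cs_spp f fx fy h1 h2 x0 y0 lam k in
      (arg_min (\<lambda>u. lin_x f fx x y u + h1 u + ereal (1 / (2 * lam) * (norm (u - x))\<^sup>2)) (\<lambda>_. True),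
       arg_min (\<lambda>v. - lin_y f fy x y v + h2 v + ereal (1 / (2 * lam) * (norm (v - y))\<^sup>2)) (\<lambda>_. True)))"

subsection \<open>The inexact proximal point framework\<close>

definition ippf_fun ::
  "('a \<Rightarrow> 'b \<Rightarrow> ereal) \<Rightarrow> ('a \<Rightarrow> ereal) \<Rightarrow> ('b \<Rightarrow> ereal) \<Rightarrow> 'a \<Rightarrow> 'b \<Rightarrow> 'a \<times> 'b \<Rightarrow> ereal" where
  "ippf_fun f h1 h2 x y = (\<lambda>(u, v).
     if u \<in> eff_dom h1 \<and> v \<in> eff_dom h2
     then saddle_fun f h1 h2 u y - saddle_fun f h1 h2 x v else \<infinity>)"

text \<open>The sequences \<open>lam, eps, del, xt, yt\<close> are only relevant from index 1 on.\<close>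

definition is_IPPF ::
  "('a::euclidean_space \<Rightarrow> 'b::euclidean_space \<Rightarrow> ereal) \<Rightarrow> ('a \<Rightarrow> ereal) \<Rightarrow> ('b \<Rightarrow> ereal) \<Rightarrow>
   real \<Rightarrow> 'a \<Rightarrow> 'b \<Rightarrow> (nat \<Rightarrow> real) \<Rightarrow> (nat \<Rightarrow> real) \<Rightarrow> (nat \<Rightarrow> real) \<Rightarrow>
   (nat \<Rightarrow> 'a) \<Rightarrow> (nat \<Rightarrow> 'b) \<Rightarrow> (nat \<Rightarrow> 'a) \<Rightarrow> (nat \<Rightarrow> 'b) \<Rightarrow> bool" where
  "is_IPPF f h1 h2 \<sigma> x0 y0 lam eps del x y xt yt \<longleftrightarrow>
     0 \<le> \<sigma> \<and> \<sigma> \<le> 1 \<and> (x0, y0) \<in> eff_dom h1 \<times> eff_dom h2 \<and> x 0 = x0 \<and> y 0 = y0 \<and>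
     (\<forall>k\<ge>1.
        lam k > 0 \<and> eps k \<ge> 0 \<and> del k > 0 \<and>
        (x k, y k) \<in> eff_dom h1 \<times> eff_dom h2 \<and>
        (xt k, yt k) \<in> eff_dom h1 \<times> eff_dom h2 \<and>
        ((x (k - 1) - x k) /\<^sub>R lam k, (y (k - 1) - y k) /\<^sub>R lam k)
          \<in> eps_subdifferential (eps k) (ippf_fun f h1 h2 (x (k - 1)) (y (k - 1))) (xt k, yt k) \<and>
        (norm (x k - xt k))\<^sup>2 + (norm (y k - yt k))\<^sup>2 + 2 * lam k * eps k
          \<le> del k + \<sigma> * ((norm (xt k - x (k - 1)))\<^sup>2 + (norm (yt k - y (k - 1)))\<^sup>2))"

end

theory Submission
  imports Defs
begin

text \<open>
  One step of the method is two independent proximal steps, one for each variable, and both have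
  the same shape.  Let \<open>\<phi>\<close> be finite and convex on \<open>dom h\<close> with subgradients \<open>G\<close> bounded by \<open>M\<close>
  (for the first variable \<open>\<phi> = f(\<cdot>, y)\<close>, for the second \<open>\<phi> = -f(x, \<cdot>)\<close>), and let \<open>p\<close> minimize
  \<open>\<phi> x + \<langle>G x, u - x\<rangle> + h u + \<parallel>u - x\<parallel>\<^sup>2 / (2 lam)\<close>.  Put
  \<open>\<epsilon> = \<phi> p - \<phi> x - \<langle>G x, p - x\<rangle>\<close>, the linearization error at \<open>p\<close>.

  The optimality condition of the minimization says that \<open>(x - p) / lam - G x\<close> is a subgradient of
  \<open>h\<close> at \<open>p\<close>.  The subgradient \<open>G x\<close> of \<open>\<phi>\<close> at \<open>x\<close> is an \<open>\<epsilon>\<close>-subgradient of \<open>\<phi>\<close> at \<open>p\<close>.  Adding the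
  two, \<open>(x - p) / lam\<close> is an \<open>\<epsilon>\<close>-subgradient of \<open>\<phi> + h\<close> at \<open>p\<close>, and adding over the two variables
  gives the inclusion of the framework with the error \<open>\<epsilon>\<close> of both variables summed
  (lemma \<open>composite_subgradient_step\<close>).

  For the error criterion, the subgradient inequality at \<open>p\<close> gives
  \<open>\<epsilon> \<le> \<langle>G p - G x, p - x\<rangle> \<le> 2 M \<parallel>p - x\<parallel>\<close>, so by Young's inequality
  \<open>2 lam \<epsilon> \<le> 4 lam\<^sup>2 M\<^sup>2 + \<parallel>p - x\<parallel>\<^sup>2\<close>.  The step size makes the first term \<open>\<delta> / 2\<close> for each of the two
  variables, and the quadratic terms are exactly what \<open>\<sigma> = 1\<close> permits.

  The minimizer exists because a lower semicontinuous function with bounded effective domain attains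
  its infimum; this is what makes the choice by \<^const>\<open>arg_min\<close> meaningful.
\<close>

section \<open>Lower semicontinuity and existence of minimizers\<close>

lemma lsc_eventually_gt:
  assumes "lsc h" and "r < h x"
  shows "eventually (\<lambda>w. r < h w) (nhds x)"
proof -
  have "r < Liminf (at x) h"
    using assms unfolding lsc_def by (meson order_less_le_trans)
  then have "eventually (\<lambda>w. r < h w) (at x)"
    by (rule less_LiminfD)
  with assms(2) show ?thesis
    by (auto simp: eventually_at_filter elim: eventually_mono)
qed

lemma lsc_add_continuous:
  fixes h :: "'a::euclidean_space \<Rightarrow> ereal" and q :: "'a \<Rightarrow> real"
  assumes "lsc h" and "\<And>x. h x \<noteq> -\<infinity>" and q: "continuous_on UNIV q"
  shows "lsc (\<lambda>x. h x + ereal (q x))"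
  unfolding lsc_def le_Liminf_iff
proof (intro allI impI)
  fix x and r :: ereal
  assume r: "r < h x + ereal (q x)"
  have "r - ereal (q x) < h x"
    using r by (cases r; cases "h x") auto
  then obtain z where z: "r - ereal (q x) < ereal z" "ereal z < h x"
    using ereal_dense2 by blast
  have "((\<lambda>w. z + q w) \<longlongrightarrow> z + q x) (at x)"
    using q by (intro tendsto_intros) (simp add: continuous_on_def)
  then have lim: "((\<lambda>w. ereal (z + q w)) \<longlongrightarrow> ereal (z + q x)) (at x)"
    by (rule tendsto_ereal)
  have "r < ereal (z + q x)"
    using z(1) by (cases r) auto
  then have "eventually (\<lambda>w. r < ereal (z + q w)) (at x)"
    by (rule order_tendstoD(1)[OF lim])
  moreover have "eventually (\<lambda>w. ereal z < h w) (at x)"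
    using lsc_eventually_gt[OF assms(1) z(2)] by (auto simp: eventually_at_filter elim: eventually_mono)
  ultimately show "eventually (\<lambda>w. r < h w + ereal (q w)) (at x)"
  proof eventually_elim
    case (elim w)
    then show ?case by (cases r; cases "h w") auto
  qed
qed

text \<open>
  If no point were a minimizer, the open superlevel sets \<open>{w. F a < F w}\<close> would cover the closure of
  the effective domain.  By compactness finitely many would suffice, but the one among these
  finitely many centres \<open>a\<close> with the least value lies in none of them.
\<close>

lemma lsc_bounded_eff_dom_attains_inf:
  fixes F :: "'a::euclidean_space \<Rightarrow> ereal"
  assumes "lsc F" and "bounded (eff_dom F)" and ne: "eff_dom F \<noteq> {}"
  shows "\<exists>p\<in>eff_dom F. \<forall>w. F p \<le> F w"
proof (rule ccontr)
  assume none: "\<not> (\<exists>p\<in>eff_dom F. \<forall>w. F p \<le> F w)"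
  define K where "K = closure (eff_dom F)"
  have lower: "\<exists>a\<in>eff_dom F. F a < F w" for w
  proof (cases "w \<in> eff_dom F")
    case True
    with none obtain a where "F a < F w"
      by (metis not_le)
    moreover from this True have "a \<in> eff_dom F"
      by (auto simp: eff_dom_def)
    ultimately show ?thesis by blast
  next
    case False
    with ne show ?thesis
      by (fastforce simp: eff_dom_def)
  qed
  have op: "open {w. F a < F w}" for a
  proof (subst open_subopen, intro ballI)
    fix x assume "x \<in> {w. F a < F w}"
    then have "eventually (\<lambda>w. F a < F w) (nhds x)"
      using lsc_eventually_gt[OF assms(1)] by simp
    then show "\<exists>T. open T \<and> x \<in> T \<and> T \<subseteq> {w. F a < F w}"
      by (auto simp: eventually_nhds)
  qed
  have "compact K"
    using assms(2) by (simp add: K_def)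
  moreover have "K \<subseteq> (\<Union>a\<in>eff_dom F. {w. F a < F w})"
    using lower by blast
  ultimately obtain C where C: "C \<subseteq> eff_dom F" "finite C" "K \<subseteq> (\<Union>a\<in>C. {w. F a < F w})"
    using op by (meson compactE_image)
  have "C \<noteq> {}"
    using C(3) ne closure_subset[of "eff_dom F"] by (auto simp: K_def)
  define c where "c = arg_min_on F C"
  have "c \<in> C"
    unfolding c_def using C(2) \<open>C \<noteq> {}\<close> by (rule arg_min_if_finite)
  moreover have "\<not> F a < F c" if "a \<in> C" for a
    unfolding c_def using arg_min_if_finite(2)[OF C(2) \<open>C \<noteq> {}\<close>] that by blast
  ultimately show False
    using C(1,3) closure_subset[of "eff_dom F"] by (fastforce simp: K_def)
qed

section \<open>The proximal step of a linearized function\<close>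

text \<open>
  Dividing by \<open>t\<close> and letting \<open>t\<close> tend to 0.  In the optimality condition below, \<open>t * a\<close> is the
  first-order change of the objective along a segment and \<open>t\<^sup>2 * b\<close> comes from the quadratic term.
\<close>

lemma nonneg_if_nonneg_up_to_second_order:
  fixes a b :: real
  assumes "\<And>t. 0 < t \<Longrightarrow> t \<le> 1 \<Longrightarrow> 0 \<le> t * a + t\<^sup>2 * b"
  shows "0 \<le> a"
proof (rule tendsto_lowerbound)
  show "((\<lambda>t. a + t * b) \<longlongrightarrow> a) (at_right 0)"
    by (auto intro!: tendsto_eq_intros)
  have "eventually (\<lambda>t. 0 < t \<and> t \<le> (1::real)) (at_right 0)"
    unfolding eventually_at_right_field by (auto intro!: exI[of _ 1])
  then show "eventually (\<lambda>t. 0 \<le> a + t * b) (at_right 0)"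
  proof eventually_elim
    case (elim t)
    then have "0 \<le> t * (a + t * b)"
      using assms[of t] by (simp add: power2_eq_square algebra_simps)
    with elim show ?case by (simp add: zero_le_mult_iff)
  qed
qed simp

lemma ereal_convex_segment:
  assumes "ereal_convex h" and "h p = ereal a" "h w = ereal b" and "0 \<le> t" "t \<le> 1"
  shows "h (p + t *\<^sub>R (w - p)) \<le> ereal ((1 - t) * a + t * b)"
proof -
  have "(1 - t) *\<^sub>R (p, a) + t *\<^sub>R (w, b) \<in> {(x, r::real). h x \<le> ereal r}"
    using assms by (intro convexD) (auto simp: ereal_convex_def)
  moreover have "(1 - t) *\<^sub>R p + t *\<^sub>R w = p + t *\<^sub>R (w - p)"
    by (simp add: algebra_simps)
  ultimately show ?thesis by simp
qed

lemma norm_add_scaleR_squared: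
  fixes e d :: "'a::real_inner"
  shows "(norm (e + t *\<^sub>R d))\<^sup>2 = (norm e)\<^sup>2 + 2 * t * (e \<bullet> d) + t\<^sup>2 * (norm d)\<^sup>2"
  unfolding power2_norm_eq_inner
  by (simp add: inner_add_left inner_add_right inner_commute[of d e] power2_eq_square distrib_left)

lemma linearized_prox_minimizer_exists:
  fixes h :: "'a::euclidean_space \<Rightarrow> ereal"
  assumes "proper h" "lsc h" and "bounded (eff_dom h)"
    and \<Phi>: "\<And>u. \<Phi> u = h u + ereal (c + g \<bullet> (u - x) + 1 / (2 * lam) * (norm (u - x))\<^sup>2)"
    and p: "p = arg_min \<Phi> (\<lambda>_. True)"
  shows "p \<in> eff_dom h" and "\<Phi> p \<le> \<Phi> w"
proof -
  have nmi: "h u \<noteq> -\<infinity>" for u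
    using assms(1) by (simp add: proper_def)
  have dom: "eff_dom \<Phi> = eff_dom h"
    by (simp add: eff_dom_def \<Phi>)
  have "continuous_on UNIV (\<lambda>u. c + g \<bullet> (u - x) + 1 / (2 * lam) * (norm (u - x))\<^sup>2)"
    by (intro continuous_intros)
  then have "lsc (\<lambda>u. h u + ereal (c + g \<bullet> (u - x) + 1 / (2 * lam) * (norm (u - x))\<^sup>2))"
    by (rule lsc_add_continuous[OF assms(2) nmi])
  then have "lsc \<Phi>"
    unfolding \<Phi>[symmetric] .
  moreover have "eff_dom h \<noteq> {}"
    using assms(1) by (auto simp: proper_def eff_dom_def)
  ultimately obtain p' where p': "p' \<in> eff_dom h" "\<And>w. \<Phi> p' \<le> \<Phi> w"
    using lsc_bounded_eff_dom_attains_inf[of \<Phi>] assms(3) dom by auto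
  have min: "\<Phi> p \<le> \<Phi> w" for w
  proof -
    have "is_arg_min \<Phi> (\<lambda>_. True) p'"
      using p'(2) by (simp add: is_arg_min_linorder)
    then have "is_arg_min \<Phi> (\<lambda>_. True) p"
      unfolding p arg_min_def by (rule someI)
    then show ?thesis by (simp add: is_arg_min_linorder)
  qed
  then show "\<Phi> p \<le> \<Phi> w" .
  have "\<Phi> p' < \<infinity>"
    using p'(1) unfolding dom[symmetric] by (simp add: eff_dom_def)
  with min[of p'] have "\<Phi> p < \<infinity>"
    by (rule le_less_trans)
  then show "p \<in> eff_dom h"
    unfolding dom[symmetric] by (simp add: eff_dom_def)
qed

text \<open>
  The optimality condition of the proximal step: \<open>(x - p) / lam - g\<close> is a subgradient of \<open>h\<close> at the
  minimizer \<open>p\<close>.  It comes from comparing \<open>p\<close> with the points \<open>p + t (w - p)\<close> for small \<open>t\<close>.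
\<close>

lemma linearized_prox_optimality:
  fixes h :: "'a::euclidean_space \<Rightarrow> ereal"
  assumes "ereal_convex h"
    and min: "\<And>w. h p + ereal (c + g \<bullet> (p - x) + 1 / (2 * lam) * (norm (p - x))\<^sup>2)
      \<le> h w + ereal (c + g \<bullet> (w - x) + 1 / (2 * lam) * (norm (w - x))\<^sup>2)"
    and hp: "h p = ereal a" and hw: "h w = ereal b" and "lam > 0"
  shows "b \<ge> a + ((x - p) /\<^sub>R lam - g) \<bullet> (w - p)"
proof -
  define d where "d = w - p"
  define slope where "slope = g \<bullet> d + b - a + (p - x) \<bullet> d / lam"
  have "0 \<le> slope"
  proof (rule nonneg_if_nonneg_up_to_second_order)
    fix t :: real assume t: "0 < t" "t \<le> 1"
    define u where "u = p + t *\<^sub>R d"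
    have "h u \<le> ereal ((1 - t) * a + t * b)"
      unfolding u_def d_def using t by (intro ereal_convex_segment[OF assms(1) hp hw]) auto
    then have "h p + ereal (c + g \<bullet> (p - x) + 1 / (2 * lam) * (norm (p - x))\<^sup>2)
      \<le> ereal ((1 - t) * a + t * b) + ereal (c + g \<bullet> (u - x) + 1 / (2 * lam) * (norm (u - x))\<^sup>2)"
      using min[of u] by (meson add_right_mono order_trans)
    then have step: "a + g \<bullet> (p - x) + 1 / (2 * lam) * (norm (p - x))\<^sup>2
      \<le> (1 - t) * a + t * b + g \<bullet> (u - x) + 1 / (2 * lam) * (norm (u - x))\<^sup>2"
      unfolding hp plus_ereal.simps ereal_less_eq by linarith
    have u: "u - x = (p - x) + t *\<^sub>R d"
      by (simp add: u_def)
    have "1 / (2 * lam) * (norm (u - x))\<^sup>2 = 1 / (2 * lam) * (norm (p - x))\<^sup>2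
        + t * ((p - x) \<bullet> d / lam) + t\<^sup>2 * ((norm d)\<^sup>2 / (2 * lam))"
      unfolding u norm_add_scaleR_squared using \<open>lam > 0\<close> by (simp add: field_simps)
    moreover have "g \<bullet> (u - x) = g \<bullet> (p - x) + t * (g \<bullet> d)"
      unfolding u by (simp add: inner_add_right)
    ultimately show "0 \<le> t * slope + t\<^sup>2 * ((norm d)\<^sup>2 / (2 * lam))"
      using step unfolding slope_def distrib_left right_diff_distrib left_diff_distrib by linarith
  qed
  moreover have "((x - p) /\<^sub>R lam - g) \<bullet> d = - ((p - x) \<bullet> d / lam) - g \<bullet> d"
    by (simp add: inner_diff_left divide_inverse algebra_simps)
  ultimately show ?thesis
    unfolding slope_def d_def by linarith
qed

section \<open>One step of the composite subgradient method in one variable\<close>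

text \<open>
  The values of \<open>\<phi>\<close> matter only on \<open>dom h\<close>, so \<open>\<phi>\<close> is taken real-valued; this keeps the arithmetic
  of the two variables away from the indeterminate forms of \<^typ>\<open>ereal\<close>.
\<close>

lemma composite_subgradient_step:
  fixes h :: "'a::euclidean_space \<Rightarrow> ereal" and \<phi> :: "'a \<Rightarrow> real" and G :: "'a \<Rightarrow> 'a"
  assumes h: "proper h" "lsc h" "ereal_convex h" "bounded (eff_dom h)"
    and sub: "\<And>u w. u \<in> eff_dom h \<Longrightarrow> w \<in> eff_dom h \<Longrightarrow> \<phi> w \<ge> \<phi> u + G u \<bullet> (w - u)"
    and bnd: "\<And>u. u \<in> eff_dom h \<Longrightarrow> norm (G u) \<le> M"
    and x: "x \<in> eff_dom h" and "lam > 0" and lam: "8 * (lam * M)\<^sup>2 \<le> \<delta>"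
    and \<Phi>: "\<And>u. \<Phi> u = h u + ereal (\<phi> x + G x \<bullet> (u - x) + 1 / (2 * lam) * (norm (u - x))\<^sup>2)"
    and p: "p = arg_min \<Phi> (\<lambda>_. True)"
    and \<epsilon>: "\<epsilon> = \<phi> p - \<phi> x - G x \<bullet> (p - x)"
  shows "p \<in> eff_dom h" and "0 \<le> \<epsilon>" and "2 * lam * \<epsilon> \<le> \<delta> / 2 + (norm (p - x))\<^sup>2"
    and "\<And>w a b. h p = ereal a \<Longrightarrow> h w = ereal b \<Longrightarrow>
      \<phi> w + b \<ge> \<phi> p + a + ((x - p) /\<^sub>R lam) \<bullet> (w - p) - \<epsilon>"
proof -
  note prox = linearized_prox_minimizer_exists[OF h(1,2,4) \<Phi> p]
  show pd: "p \<in> eff_dom h"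
    by (rule prox(1))
  show "0 \<le> \<epsilon>"
    using sub[OF x pd] by (simp add: \<epsilon>)
  have "\<epsilon> \<le> (G p - G x) \<bullet> (p - x)"
    using sub[OF pd x] by (simp add: \<epsilon> inner_simps)
  also have "\<dots> \<le> norm (G p - G x) * norm (p - x)"
    by (rule norm_cauchy_schwarz)
  also have "\<dots> \<le> (2 * M) * norm (p - x)"
    using norm_triangle_ineq4[of "G p" "G x"] bnd[OF pd] bnd[OF x] by (intro mult_right_mono) auto
  finally have "2 * lam * \<epsilon> \<le> 2 * (2 * (lam * M)) * norm (p - x)"
    using \<open>lam > 0\<close> by (simp add: mult_left_mono mult.assoc mult.left_commute)
  also have "\<dots> \<le> (2 * (lam * M))\<^sup>2 + (norm (p - x))\<^sup>2"
    by (rule sum_squares_bound)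
  also have "\<dots> \<le> \<delta> / 2 + (norm (p - x))\<^sup>2"
    using lam by (simp add: power_mult_distrib)
  finally show "2 * lam * \<epsilon> \<le> \<delta> / 2 + (norm (p - x))\<^sup>2" .
  fix w a b assume hp: "h p = ereal a" and hw: "h w = ereal b"
  have "w \<in> eff_dom h"
    by (simp add: eff_dom_def hw)
  \<comment> \<open>This makes \<open>G x\<close> an \<open>\<epsilon>\<close>-subgradient of \<open>\<phi>\<close> at \<open>p\<close>.\<close>
  from sub[OF x this] have "\<phi> w \<ge> \<phi> p + G x \<bullet> (w - p) - \<epsilon>"
    by (simp add: \<epsilon> inner_simps)
  moreover have "b \<ge> a + ((x - p) /\<^sub>R lam - G x) \<bullet> (w - p)"
    using prox(2) by (intro linearized_prox_optimality[OF h(3) _ hp hw \<open>lam > 0\<close>]) (simp add: \<Phi>)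
  ultimately show "\<phi> w + b \<ge> \<phi> p + a + ((x - p) /\<^sub>R lam) \<bullet> (w - p) - \<epsilon>"
    by (simp add: inner_diff_left[of _ "G x"])
qed

section \<open>The composite subgradient method as an inexact proximal point method\<close>

theorem proposition4p2:
  fixes f :: "'a::euclidean_space \<Rightarrow> 'b::euclidean_space \<Rightarrow> ereal"
    and h1 :: "'a \<Rightarrow> ereal" and h2 :: "'b \<Rightarrow> ereal"
    and fx :: "'a \<Rightarrow> 'b \<Rightarrow> 'a" and fy :: "'a \<Rightarrow> 'b \<Rightarrow> 'b"
    and M D \<delta> lam :: real
    and x0 :: 'a and y0 :: 'b and x :: "nat \<Rightarrow> 'a" and y :: "nat \<Rightarrow> 'b"
  assumes "\<And>v. ereal_convex (\<lambda>u. f u v)"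
    and "\<And>u. ereal_concave (\<lambda>v. f u v)"
    and "proper h1" "lsc h1" "ereal_convex h1"
    and "proper h2" "lsc h2" "ereal_convex h2"
    and "eff_dom h1 \<times> eff_dom h2 \<subseteq> saddle_dom f"
    and "\<And>u v. (u, v) \<in> eff_dom h1 \<times> eff_dom h2 \<Longrightarrow> subgradient (\<lambda>u'. f u' v) u (fx u v)"
    and "\<And>u v. (u, v) \<in> eff_dom h1 \<times> eff_dom h2 \<Longrightarrow> supergradient (\<lambda>v'. f u v') v (fy u v)"
    and "M > 0"
    and "\<And>u v. (u, v) \<in> eff_dom h1 \<times> eff_dom h2 \<Longrightarrow> norm (fx u v) \<le> M \<and> norm (fy u v) \<le> M"
    and "bounded (eff_dom h1 \<times> eff_dom h2)"
    and "diameter (eff_dom h1 \<times> eff_dom h2) = D" and "D > 0"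
    and "saddle_points f h1 h2 \<noteq> {}"
    and "(x0, y0) \<in> eff_dom h1 \<times> eff_dom h2"
    and "\<delta> > 0"
    and "lam = sqrt (\<delta> / (8 * M\<^sup>2))"
    and "\<And>k. (x k, y k) = cs_spp f fx fy h1 h2 x0 y0 lam k"
  shows "\<exists>epsx epsy :: nat \<Rightarrow> real.
    (\<forall>k\<ge>1.
       ereal (epsx k) = f (x k) (y (k - 1)) - lin_x f fx (x (k - 1)) (y (k - 1)) (x k) \<and>
       ereal (epsy k) = - f (x (k - 1)) (y k) + lin_y f fy (x (k - 1)) (y (k - 1)) (y k)) \<and>
    is_IPPF f h1 h2 1 x0 y0 (\<lambda>_. lam) (\<lambda>k. epsx k + epsy k) (\<lambda>_. \<delta>) x y x y"
proof -
  note hx = assms(3-5) and hy = assms(6-8)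
  let ?X = "eff_dom h1" and ?Y = "eff_dom h2"
  have "lam > 0"
    using assms(12,19,20) by simp
  have lam: "8 * (lam * M)\<^sup>2 \<le> \<delta>"
    using assms(12,19,20) by (simp add: power_mult_distrib)
  have start: "x0 \<in> ?X" "y0 \<in> ?Y"
    using assms(18) by auto
  have bdd: "bounded ?X" "bounded ?Y"
    using bounded_fst[OF assms(14)] bounded_snd[OF assms(14)] start by (auto split: if_splits)

  define F where "F u v = real_of_ereal (f u v)" for u v
  have F: "f u v = ereal (F u v)" if "u \<in> ?X" "v \<in> ?Y" for u v
    using assms(9) that by (auto simp: F_def saddle_dom_def ereal_real)
  have subx: "F w v \<ge> F u v + fx u v \<bullet> (w - u)" if "u \<in> ?X" "w \<in> ?X" "v \<in> ?Y" for u w v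
    using assms(10)[of u v] that by (auto simp: subgradient_def F dest: spec[of _ w])
  have suby: "- F u w \<ge> - F u v + (- fy u v) \<bullet> (w - v)" if "u \<in> ?X" "v \<in> ?Y" "w \<in> ?Y" for u v w
  proof -
    have "f u w \<le> f u v + ereal (fy u v \<bullet> (w - v))"
      using assms(11)[of u v] that by (auto simp: supergradient_def)
    then show ?thesis using that by (simp add: F)
  qed
  define H1 where "H1 u = real_of_ereal (h1 u)" for u
  have H1: "h1 u = ereal (H1 u)" if "u \<in> ?X" for u
    using hx(1) that by (cases "h1 u") (auto simp: proper_def eff_dom_def H1_def)
  define H2 where "H2 v = real_of_ereal (h2 v)" for v
  have H2: "h2 v = ereal (H2 v)" if "v \<in> ?Y" for v
    using hy(1) that by (cases "h2 v") (auto simp: proper_def eff_dom_def H2_def)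

  \<comment> \<open>The second error is that of the first with \<open>-f(x, \<cdot>)\<close> in place of \<open>f(\<cdot>, y)\<close>; it is left
    unsimplified to show this.\<close>
  define epsx where "epsx k =
    F (x k) (y (k - 1)) - F (x (k - 1)) (y (k - 1)) -
    fx (x (k - 1)) (y (k - 1)) \<bullet> (x k - x (k - 1))" for k
  define epsy where "epsy k =
    - F (x (k - 1)) (y k) - - F (x (k - 1)) (y (k - 1)) -
    (- fy (x (k - 1)) (y (k - 1))) \<bullet> (y k - y (k - 1))" for k

  have init: "x 0 = x0" "y 0 = y0"
    using assms(21)[of 0] by auto

  \<comment> \<open>The two objectives with the values of \<open>f\<close> as reals and \<open>h\<close> as the only extended-real summand,
    which is how the one-variable step takes them.\<close>
  define \<Phi> where "\<Phi> k u = h1 u + ereal (F (x k) (y k) + fx (x k) (y k) \<bullet> (u - x k)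
    + 1 / (2 * lam) * (norm (u - x k))\<^sup>2)" for k u
  define \<Psi> where "\<Psi> k v = h2 v + ereal (- F (x k) (y k) + (- fy (x k) (y k)) \<bullet> (v - y k)
    + 1 / (2 * lam) * (norm (v - y k))\<^sup>2)" for k v
  have iter: "x (Suc k) = arg_min (\<Phi> k) (\<lambda>_. True)" "y (Suc k) = arg_min (\<Psi> k) (\<lambda>_. True)"
    if "x k \<in> ?X" "y k \<in> ?Y" for k
  proof -
    have "(\<lambda>u. lin_x f fx (x k) (y k) u + h1 u + ereal (1 / (2 * lam) * (norm (u - x k))\<^sup>2)) = \<Phi> k"
    proof
      fix u show "lin_x f fx (x k) (y k) u + h1 u + ereal (1 / (2 * lam) * (norm (u - x k))\<^sup>2) = \<Phi> k u"
        unfolding \<Phi>_def lin_x_def F[OF that] by (cases "h1 u") auto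
    qed
    moreover have
      "(\<lambda>v. - lin_y f fy (x k) (y k) v + h2 v + ereal (1 / (2 * lam) * (norm (v - y k))\<^sup>2)) = \<Psi> k"
    proof
      fix v show "- lin_y f fy (x k) (y k) v + h2 v + ereal (1 / (2 * lam) * (norm (v - y k))\<^sup>2) = \<Psi> k v"
        unfolding \<Psi>_def lin_y_def F[OF that] by (cases "h2 v") auto
    qed
    ultimately show "x (Suc k) = arg_min (\<Phi> k) (\<lambda>_. True)" "y (Suc k) = arg_min (\<Psi> k) (\<lambda>_. True)"
      using assms(21)[of "Suc k"] by (simp_all add: assms(21)[of k, symmetric])
  qed

  have stepx: "x (Suc k) \<in> ?X" "0 \<le> epsx (Suc k)"
      "2 * lam * epsx (Suc k) \<le> \<delta> / 2 + (norm (x (Suc k) - x k))\<^sup>2"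
      "\<And>w a b. h1 (x (Suc k)) = ereal a \<Longrightarrow> h1 w = ereal b \<Longrightarrow>
        F w (y k) + b \<ge> F (x (Suc k)) (y k) + a
          + ((x k - x (Suc k)) /\<^sub>R lam) \<bullet> (w - x (Suc k)) - epsx (Suc k)"
    if "x k \<in> ?X" "y k \<in> ?Y" for k
  proof -
    have sub: "F w (y k) \<ge> F u (y k) + fx u (y k) \<bullet> (w - u)" if "u \<in> ?X" "w \<in> ?X" for u w
      using subx that \<open>y k \<in> ?Y\<close> by blast
    have bnd: "norm (fx u (y k)) \<le> M" if "u \<in> ?X" for u
      using assms(13) that \<open>y k \<in> ?Y\<close> by blast
    have eps: "epsx (Suc k)
        = F (x (Suc k)) (y k) - F (x k) (y k) - fx (x k) (y k) \<bullet> (x (Suc k) - x k)"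
      by (simp add: epsx_def)
    note step = composite_subgradient_step[where \<phi> = "\<lambda>u. F u (y k)" and G = "\<lambda>u. fx u (y k)"
        and \<Phi> = "\<Phi> k", OF hx bdd(1) sub bnd that(1) \<open>lam > 0\<close> lam \<Phi>_def iter(1)[OF that] eps]
    show "x (Suc k) \<in> ?X" by (rule step(1))
    show "0 \<le> epsx (Suc k)" by (rule step(2))
    show "2 * lam * epsx (Suc k) \<le> \<delta> / 2 + (norm (x (Suc k) - x k))\<^sup>2" by (rule step(3))
    show "F w (y k) + b \<ge> F (x (Suc k)) (y k) + a
          + ((x k - x (Suc k)) /\<^sub>R lam) \<bullet> (w - x (Suc k)) - epsx (Suc k)"
      if "h1 (x (Suc k)) = ereal a" "h1 w = ereal b" for w a b
      using that by (intro step(4))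
  qed
  have stepy: "y (Suc k) \<in> ?Y" "0 \<le> epsy (Suc k)"
      "2 * lam * epsy (Suc k) \<le> \<delta> / 2 + (norm (y (Suc k) - y k))\<^sup>2"
      "\<And>w a b. h2 (y (Suc k)) = ereal a \<Longrightarrow> h2 w = ereal b \<Longrightarrow>
        - F (x k) w + b \<ge> - F (x k) (y (Suc k)) + a
          + ((y k - y (Suc k)) /\<^sub>R lam) \<bullet> (w - y (Suc k)) - epsy (Suc k)"
    if "x k \<in> ?X" "y k \<in> ?Y" for k
  proof -
    have sub: "- F (x k) w \<ge> - F (x k) v + (- fy (x k) v) \<bullet> (w - v)" if "v \<in> ?Y" "w \<in> ?Y" for v w
      using suby that \<open>x k \<in> ?X\<close> by blast
    have bnd: "norm (- fy (x k) v) \<le> M" if "v \<in> ?Y" for v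
      unfolding norm_minus_cancel using assms(13) that \<open>x k \<in> ?X\<close> by blast
    have eps: "epsy (Suc k)
        = - F (x k) (y (Suc k)) - - F (x k) (y k) - (- fy (x k) (y k)) \<bullet> (y (Suc k) - y k)"
      by (simp add: epsy_def)
    note step = composite_subgradient_step[where \<phi> = "\<lambda>v. - F (x k) v" and G = "\<lambda>v. - fy (x k) v"
        and \<Phi> = "\<Psi> k", OF hy bdd(2) sub bnd that(2) \<open>lam > 0\<close> lam \<Psi>_def iter(2)[OF that] eps]
    show "y (Suc k) \<in> ?Y" by (rule step(1))
    show "0 \<le> epsy (Suc k)" by (rule step(2))
    show "2 * lam * epsy (Suc k) \<le> \<delta> / 2 + (norm (y (Suc k) - y k))\<^sup>2" by (rule step(3))
    show "- F (x k) w + b \<ge> - F (x k) (y (Suc k)) + a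
          + ((y k - y (Suc k)) /\<^sub>R lam) \<bullet> (w - y (Suc k)) - epsy (Suc k)"
      if "h2 (y (Suc k)) = ereal a" "h2 w = ereal b" for w a b
      using that by (intro step(4))
  qed

  have dom: "x k \<in> ?X \<and> y k \<in> ?Y" for k
    by (induction k) (use init start stepx(1) stepy(1) in auto)

  have eps_eq: "ereal (epsx k) = f (x k) (y (k - 1)) - lin_x f fx (x (k - 1)) (y (k - 1)) (x k)"
      "ereal (epsy k) = - f (x (k - 1)) (y k) + lin_y f fy (x (k - 1)) (y (k - 1)) (y k)" for k
    using dom by (simp_all add: F lin_x_def lin_y_def epsx_def epsy_def)

  have ippf: "is_IPPF f h1 h2 1 x0 y0 (\<lambda>_. lam) (\<lambda>k. epsx k + epsy k) (\<lambda>_. \<delta>) x y x y"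
    unfolding is_IPPF_def
  proof (intro conjI allI impI)
    fix k :: nat assume "1 \<le> k"
    then obtain j where k: "k = Suc j" by (cases k) auto
    have j: "x j \<in> ?X" "y j \<in> ?Y" and k_dom: "x k \<in> ?X" "y k \<in> ?Y"
      using dom by auto
    show "0 \<le> epsx k + epsy k"
      using stepx(2)[OF j] stepy(2)[OF j] by (simp add: k)
    show "(norm (x k - x k))\<^sup>2 + (norm (y k - y k))\<^sup>2 + 2 * lam * (epsx k + epsy k)
        \<le> \<delta> + 1 * ((norm (x k - x (k - 1)))\<^sup>2 + (norm (y k - y (k - 1)))\<^sup>2)"
      using stepx(3)[OF j] stepy(3)[OF j] by (simp add: k algebra_simps)
    let ?s = "(x (k - 1) - x k) /\<^sub>R lam" and ?t = "(y (k - 1) - y k) /\<^sub>R lam"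
    show "(?s, ?t) \<in> eps_subdifferential (epsx k + epsy k)
        (ippf_fun f h1 h2 (x (k - 1)) (y (k - 1))) (x k, y k)"
      unfolding eps_subdifferential_def
    proof (intro CollectI allI)
      fix w :: "'a \<times> 'b"
      obtain u v where w: "w = (u, v)" by (cases w)
      have val: "ippf_fun f h1 h2 (x j) (y j) (u, v) =
          ereal (F u (y j) + H1 u - H2 (y j) - (F (x j) v + H1 (x j) - H2 v))"
        if "u \<in> ?X" "v \<in> ?Y" for u v
        using that j by (simp add: ippf_fun_def saddle_fun_def F H1 H2)
      show "ippf_fun f h1 h2 (x (k - 1)) (y (k - 1)) (x k, y k)
          + ereal ((?s, ?t) \<bullet> (w - (x k, y k))) - ereal (epsx k + epsy k)
          \<le> ippf_fun f h1 h2 (x (k - 1)) (y (k - 1)) w"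
      proof (cases "u \<in> ?X \<and> v \<in> ?Y")
        case True
        then have "u \<in> ?X" "v \<in> ?Y" by auto
        \<comment> \<open>The terms \<open>H2 (y j)\<close> and \<open>H1 (x j)\<close> of \<open>val\<close> do not depend on \<open>(u, v)\<close> and cancel.\<close>
        have "F u (y j) + H1 u \<ge> F (x k) (y j) + H1 (x k) + ?s \<bullet> (u - x k) - epsx k"
          using stepx(4)[OF j, of "H1 (x k)" u "H1 u"] H1 k_dom(1) \<open>u \<in> ?X\<close> by (simp add: k)
        moreover have "- F (x j) v + H2 v \<ge> - F (x j) (y k) + H2 (y k) + ?t \<bullet> (v - y k) - epsy k"
          using stepy(4)[OF j, of "H2 (y k)" v "H2 v"] H2 k_dom(2) \<open>v \<in> ?Y\<close> by (simp add: k)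
        moreover have "(?s, ?t) \<bullet> (w - (x k, y k)) = ?s \<bullet> (u - x k) + ?t \<bullet> (v - y k)"
          by (simp add: w)
        moreover have "k - 1 = j"
          by (simp add: k)
        ultimately show ?thesis
          unfolding w by (simp add: val k_dom \<open>u \<in> ?X\<close> \<open>v \<in> ?Y\<close> del: inner_Pair)
      next
        case False
        then have "ippf_fun f h1 h2 (x (k - 1)) (y (k - 1)) w = \<infinity>"
          by (auto simp: w ippf_fun_def)
        then show ?thesis by simp
      qed
    qed
  qed (use start init dom \<open>lam > 0\<close> assms(19) in auto)

  show ?thesis
    by (intro exI[of _ epsx] exI[of _ epsy] conjI allI impI eps_eq ippf)
qed

end
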